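(* Every ring in either of the following two classes satisfies property $(\star)$: (A) local rings $(R,\mathfrak{m})$ for which there is a fixed field $\kappa\subseteq R$ such that every invertible element of $R$ can be written as $x+u$ with $x\in\mathfrak{m}$ and $u\in\kappa$; (B) rings $R$ for which there are a subfield $\kappa$ of $R$ with $U(R)\subseteq\kappa$ and a fixed maximal ideal $\mathfrak{m}$ of $R$ such that every non-invertible element of $R$ can be written as $x+u$ with $x\in\mathfrak{m}$ and $u\in\kappa$.
   Context: Conventions: rings are associative and unitary (not necessarily commutative), ring homomorphisms preserve $1$, ideals are two-sided, and subfields share the same $1$. Fields are commutative. $U(R)$ is the set of invertible elements of $R$. A ring $R$ is local with maximal ideal $\mathfrak{m}$ if its non-invertible elements form a proper ideal, namely $\mathfrak{m}$ (which is then the unique maximal ideal). Property $(\star)$ for a ring $R$: there exists a maximal ideal $\mathfrak{m}$ of $R$ such that the canonical projection $\pi\colon R\to R/\mathfrak{m}$ has a section (a ring homomorphism $s\colon R/\mathfrak m\to R$ with $\pi\circ s=\mathrm{id}$), so that $R/\mathfrak{m}$ is isomorphic to a field $\kappa$ contained in $R$. *)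

theory Defs
  imports "HOL-Algebra.Subrings"
begin

text \<open>
  Nothing here assumes commutativity: \<^term>\<open>ring\<close> is the locale of associative unitary rings,
  \<^term>\<open>ideal\<close> and \<^term>\<open>maximalideal\<close> are two-sided, \<^term>\<open>ring_hom\<close> preserves
  \<open>\<one>\<close>, and \<^term>\<open>subfield\<close> demands commutativity of the subset only, with the same \<open>\<one>\<close>.
\<close>

definition local_ring_with :: "('a, 'b) ring_scheme \<Rightarrow> 'a set \<Rightarrow> bool"
  where "local_ring_with R m \<longleftrightarrow>
    ring R \<and> m = carrier R - Units R \<and> ideal m R \<and> m \<noteq> carrier R"

definition class_A :: "('a, 'b) ring_scheme \<Rightarrow> bool"
  where "class_A R \<longleftrightarrow>
    (\<exists>m. local_ring_with R m \<and>
      (\<exists>\<kappa>. subfield \<kappa> R \<and>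
        (\<forall>a \<in> Units R. \<exists>x \<in> m. \<exists>u \<in> \<kappa>. a = x \<oplus>\<^bsub>R\<^esub> u)))"

definition class_B :: "('a, 'b) ring_scheme \<Rightarrow> bool"
  where "class_B R \<longleftrightarrow>
    ring R \<and>
    (\<exists>\<kappa> m. subfield \<kappa> R \<and> Units R \<subseteq> \<kappa> \<and> maximalideal m R \<and>
      (\<forall>a \<in> carrier R - Units R. \<exists>x \<in> m. \<exists>u \<in> \<kappa>. a = x \<oplus>\<^bsub>R\<^esub> u))"

definition quot_proj :: "('a, 'b) ring_scheme \<Rightarrow> 'a set \<Rightarrow> 'a \<Rightarrow> 'a set"
  where "quot_proj R m x = m +>\<^bsub>R\<^esub> x"

definition proj_section :: "('a, 'b) ring_scheme \<Rightarrow> 'a set \<Rightarrow> ('a set \<Rightarrow> 'a) \<Rightarrow> bool"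
  where "proj_section R m s \<longleftrightarrow>
    s \<in> ring_hom (R Quot m) R \<and> (\<forall>X \<in> carrier (R Quot m). quot_proj R m (s X) = X)"

text \<open>
  For noncommutative \<open>R\<close> the quotient by a maximal ideal is merely a simple ring, so being
  isomorphic to a field in \<open>R\<close> is a separate part of the property: the section is required to
  be an isomorphism onto such a field.
\<close>

definition property_star :: "('a, 'b) ring_scheme \<Rightarrow> bool"
  where "property_star R \<longleftrightarrow>
    (\<exists>m. maximalideal m R \<and>
      (\<exists>s \<kappa>. proj_section R m s \<and> subfield \<kappa> R \<and>
        s \<in> ring_iso (R Quot m) (R\<lparr>carrier := \<kappa>\<rparr>)))"

end

(* The composite \<kappa> \<rightarrow> R \<rightarrow> R/m is injective because a nonzero element of \<kappa> is a unit of R and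
   so avoids m, and it is surjective as soon as R = m + \<kappa>; its inverse is the section. In class (A)
   the non-units are the elements of m = m + 0, in class (B) the units lie in 0 + \<kappa>, so R = m + \<kappa>
   in both cases. *)

theory Submission
  imports Defs
begin

context ring
begin

text \<open>A unit \<open>a\<close> in \<open>I\<close> would put \<open>a \<otimes> inv a\<close>,
  that is \<open>\<one>\<close>, into \<open>I\<close>.\<close>

lemma ideal_disjoint_Units:
  assumes "ideal I R" and "I \<noteq> carrier R"
  shows "I \<inter> Units R = {}"
proof (rule ccontr)
  assume "I \<inter> Units R \<noteq> {}"
  then obtain a where a: "a \<in> I" "a \<in> Units R" by blast
  hence "\<one> \<in> I"
    using ideal.I_r_closed[OF assms(1) a(1) Units_inv_closed[OF a(2)]] by simp
  thus False using ideal.one_imp_carrier[OF assms(1)] assms(2) by blast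
qed

text \<open>An ideal \<open>J\<close> other than the whole ring contains no units, so it lies inside
  the set of non-units, which is \<open>m\<close>.\<close>

lemma local_ring_with_imp_maximalideal:
  assumes "local_ring_with R m"
  shows "maximalideal m R"
proof (rule maximalidealI)
  have m: "m = carrier R - Units R" "ideal m R" "m \<noteq> carrier R"
    using assms by (auto simp: local_ring_with_def)
  show "ideal m R" "carrier R \<noteq> m" using m by auto
  show "J = m \<or> J = carrier R" if "ideal J R" "m \<subseteq> J" "J \<subseteq> carrier R" for J
    using ideal_disjoint_Units[OF that(1)] that m(1) by blast
qed

text \<open>Product and \<open>\<one>\<close> of \<kappa> are those of \<open>R\<close>, so a
  two-sided inverse found in \<kappa> is also one in \<open>R\<close>.\<close>

lemma subfield_nonzero_Units:
  assumes "subfield \<kappa> R"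
  shows "\<kappa> - {\<zero>} \<subseteq> Units R"
proof
  fix u assume u: "u \<in> \<kappa> - {\<zero>}"
  have sub: "\<kappa> \<subseteq> carrier R" by (rule subdomainE(1)[OF subfield.axioms(1)[OF assms]])
  have "u \<in> Units (R\<lparr>carrier := \<kappa>\<rparr>)"
    using u subfield.subfield_Units[OF assms] by simp
  then obtain v where "v \<in> \<kappa>" "v \<otimes> u = \<one>" "u \<otimes> v = \<one>"
    unfolding Units_def by auto
  with u sub show "u \<in> Units R" unfolding Units_def by blast
qed

lemma rcos_ring_iso_subfield:
  assumes m: "ideal m R" "m \<noteq> carrier R"
    and \<kappa>: "subfield \<kappa> R"
    and decomp: "\<And>a. a \<in> carrier R \<Longrightarrow> \<exists>x \<in> m. \<exists>u \<in> \<kappa>. a = x \<oplus> u"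
  shows "(+>) m \<in> ring_iso (R\<lparr>carrier := \<kappa>\<rparr>) (R Quot m)"
proof -
  interpret ideal m R by (rule m(1))
  have sd: "subdomain \<kappa> R" by (rule subfield.axioms(1)[OF \<kappa>])
  have sub: "\<kappa> \<subseteq> carrier R" by (rule subdomainE(1)[OF sd])
  have hom: "(+>) m \<in> ring_hom (R\<lparr>carrier := \<kappa>\<rparr>) (R Quot m)"
    using rcos_ring_hom sub by (simp add: ring_hom_def Pi_iff subset_iff)
  have inj: "inj_on ((+>) m) \<kappa>"
  proof (rule inj_onI)
    fix u v assume uv: "u \<in> \<kappa>" "v \<in> \<kappa>" "m +> u = m +> v"
    hence carr: "u \<in> carrier R" "v \<in> carrier R" using sub by auto
    have "u \<ominus> v \<in> m"
      using quotient_eq_iff_same_a_r_cos[OF m(1) carr] uv(3) by simp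
    moreover have "u \<ominus> v \<in> \<kappa>"
      using uv subdomainE(5,7)[OF sd] by (simp add: a_minus_def)
    \<comment> \<open>Otherwise the difference would be a nonzero element of \<kappa>, hence a unit
      of \<open>R\<close> inside the proper ideal \<open>m\<close>.\<close>
    ultimately have "u \<ominus> v = \<zero>"
      using subfield_nonzero_Units[OF \<kappa>] ideal_disjoint_Units[OF m] by blast
    thus "u = v" using carr by simp
  qed
  have surj: "(+>) m ` \<kappa> = carrier (R Quot m)"
  proof
    show "(+>) m ` \<kappa> \<subseteq> carrier (R Quot m)"
      using sub by (auto simp: FactRing_def A_RCOSETS_def')
    show "carrier (R Quot m) \<subseteq> (+>) m ` \<kappa>"
    proof
      fix X assume "X \<in> carrier (R Quot m)"
      then obtain a where a: "a \<in> carrier R" "X = m +> a"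
        by (auto simp: FactRing_def A_RCOSETS_def')
      obtain x u where xu: "x \<in> m" "u \<in> \<kappa>" "a = x \<oplus> u"
        using decomp[OF a(1)] by blast
      have u: "u \<in> carrier R" and x: "x \<in> carrier R" using xu sub Icarr by blast+
      \<comment> \<open>The \<kappa>-summand \<open>u\<close> of \<open>a\<close> is the required
        preimage: it differs from \<open>a\<close> by an element of \<open>m\<close>, so both have
        the same coset.\<close>
      have "a \<ominus> u = x"
        using u x by (simp add: xu(3) a_minus_def a_assoc r_neg)
      hence "m +> a = m +> u"
        using quotient_eq_iff_same_a_r_cos[OF m(1) a(1) u] xu(1) by simp
      thus "X \<in> (+>) m ` \<kappa>" using a xu by blast
    qed
  qed
  show ?thesis
    using hom inj surj by (simp add: ring_iso_def bij_betw_def)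
qed

text \<open>The criterion shared by both classes: it remains for each of them to provide a maximal
  \<open>m\<close> and the decomposition of every element.\<close>

lemma property_starI:
  assumes m: "maximalideal m R"
    and \<kappa>: "subfield \<kappa> R"
    and decomp: "\<And>a. a \<in> carrier R \<Longrightarrow> \<exists>x \<in> m. \<exists>u \<in> \<kappa>. a = x \<oplus> u"
  shows "property_star R"
proof -
  \<comment> \<open>\<open>s\<close> sends a coset to its representative in \<kappa>, which exists
    and is unique by \<open>iso\<close>.\<close>
  define s where "s = inv_into \<kappa> ((+>) m)"
  have sd: "subdomain \<kappa> R" by (rule subfield.axioms(1)[OF \<kappa>])
  have iso: "(+>) m \<in> ring_iso (R\<lparr>carrier := \<kappa>\<rparr>) (R Quot m)"
    using rcos_ring_iso_subfield[OF maximalideal.axioms(1)[OF m] _ \<kappa> decomp]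
      maximalideal.I_notcarr[OF m] by blast
  \<comment> \<open>Inverting \<open>iso\<close> requires its source to be a ring; \<kappa> is one,
    being even a domain.\<close>
  have s_iso: "s \<in> ring_iso (R Quot m) (R\<lparr>carrier := \<kappa>\<rparr>)"
    using ring_iso_set_sym[OF domain.axioms(1)[OF subdomain_is_domain[OF sd],
      THEN cring.axioms(1)] iso] by (simp add: s_def)
  \<comment> \<open>Only the codomain grows, from \<kappa> to \<open>R\<close>; the operations and
    \<open>\<one>\<close> stay the same.\<close>
  hence "s \<in> ring_hom (R Quot m) R"
    using subdomainE(1)[OF sd] by (auto simp: ring_iso_def ring_hom_def)
  moreover have "m +> s X = X" if "X \<in> carrier (R Quot m)" for X
    using iso that by (simp add: s_def ring_iso_def bij_betw_def f_inv_into_f)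
  ultimately have "proj_section R m s"
    by (simp add: proj_section_def quot_proj_def)
  thus ?thesis using m \<kappa> s_iso by (auto simp: property_star_def)
qed

lemma class_A_imp_property_star:
  assumes "class_A R"
  shows "property_star R"
proof -
  obtain m \<kappa> where m: "local_ring_with R m" and \<kappa>: "subfield \<kappa> R"
    and decomp: "\<forall>a \<in> Units R. \<exists>x \<in> m. \<exists>u \<in> \<kappa>. a = x \<oplus> u"
    using assms by (auto simp: class_A_def)
  have "\<exists>x \<in> m. \<exists>u \<in> \<kappa>. a = x \<oplus> u" if "a \<in> carrier R" for a
  proof (cases "a \<in> Units R")
    case False
    hence "a \<in> m" using m that by (simp add: local_ring_with_def)
    moreover have "\<zero> \<in> \<kappa>" by (rule subdomainE(2)[OF subfield.axioms(1)[OF \<kappa>]])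
    ultimately show ?thesis using that r_zero[symmetric] by blast
  qed (use decomp in blast)
  \<comment> \<open>Locality enters a second time here, to make \<open>m\<close> maximal.\<close>
  thus ?thesis
    using property_starI[OF local_ring_with_imp_maximalideal[OF m] \<kappa>] by blast
qed

lemma class_B_imp_property_star:
  assumes "class_B R"
  shows "property_star R"
proof -
  obtain m \<kappa> where m: "maximalideal m R" and \<kappa>: "subfield \<kappa> R" "Units R \<subseteq> \<kappa>"
    and decomp: "\<forall>a \<in> carrier R - Units R. \<exists>x \<in> m. \<exists>u \<in> \<kappa>. a = x \<oplus> u"
    using assms by (auto simp: class_B_def)
  have "\<exists>x \<in> m. \<exists>u \<in> \<kappa>. a = x \<oplus> u" if "a \<in> carrier R" for a
  proof (cases "a \<in> Units R")
    case True
    \<comment> \<open>This is the \<open>m\<close>-summand; the unit \<open>a\<close> is its own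
      \<kappa>-summand.\<close>
    have "\<zero> \<in> m"
      using m by (simp add: additive_subgroup.zero_closed ideal_def maximalideal_def)
    thus ?thesis using True \<kappa>(2) that l_zero[symmetric] by blast
  qed (use decomp that in blast)
  thus ?thesis using property_starI[OF m \<kappa>(1)] by blast
qed

end

theorem theorem3p7:
  fixes R :: "('a, 'b) ring_scheme"
  assumes "ring R"
    and "class_A R \<or> class_B R"
  shows "property_star R"
  using assms ring.class_A_imp_property_star ring.class_B_imp_property_star by blast

end
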